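(* Let $\lambda$ be a partition with $n$ parts and let $\beta$ be an upper $\lambda$-tuple, i.e. $\beta \in U_\lambda(n)$. Then the terminal pair $(\lambda,\beta)$ is nonpermutable if and only if $\beta$ is a gapless core $\lambda$-tuple that is bounded by its platform, i.e. if and only if $\beta \in UGC_\lambda(n) \cap UBP_\lambda(n)$.
   Context: Fix an integer $n \geq 1$ and write $[k] = \{1,\dots,k\}$ and $(a,b] = \{a+1,\dots,b\}$. A partition is $\lambda = (\lambda_1,\dots,\lambda_n)$ with $\lambda_1 \geq \dots \geq \lambda_n \geq 0$ integers. Let $R_\lambda \subseteq [n-1]$ be the set of $q \in [n-1]$ with $\lambda_q > \lambda_{q+1}$ (equivalently, the set of distinct column lengths of the Young diagram of $\lambda$ that are less than $n$); write its elements $q_1 < \dots < q_r$ ($r \geq 0$), and set $q_0 := 0$, $q_{r+1} := n$. For $h \in [r+1]$ the $h$-th carrel is the index interval $(q_{h-1}, q_h]$. A $\lambda$-tuple is an $n$-tuple $\beta = (\beta_1,\dots,\beta_n)$ with entries in $[n]$, considered together with this carrel structure; it is upper if $\beta_i \geq i$ for all $i \in [n]$. $U_\lambda(n)$ denotes the set of upper $\lambda$-tuples, partially ordered entrywise. Critical indices: let $\beta \in U_\lambda(n)$ and $h \in [r+1]$. Set $x_1 := q_h$. Recursively, given $x_{u-1}$, if there is an index $x$ with $q_{h-1} < x < x_{u-1}$ and $\beta_{x_{u-1}} - \beta_x > x_{u-1} - x$, let $x_u$ be the largest such $x$; otherwise stop. The indices $x_1 > x_2 > \cdots$ so obtained are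 the critical indices of $\beta$ in the $h$-th carrel; the pairs $(x_u, \beta_{x_u})$ are its critical pairs, and the sequence over $h$ of the sets of critical pairs is the critical list of $\beta$. For $i \in [n]$ let $x(i)$ be the smallest critical index of $\beta$ lying in the carrel containing $i$ with $x(i) \geq i$. The $\lambda$-platform of $\beta$ is $\Xi_\lambda(\beta) := \xi$ with $\xi_i := \beta_{x(i)}$ for $i \in [n]$. The critical list of $\beta$ is a flag critical list if for every $h \in [r]$ one has $\beta_{q_h} \leq \beta_k$, where $k$ is the smallest critical index of $\beta$ in the $(h+1)$-st carrel. $UGC_\lambda(n)$ (gapless core $\lambda$-tuples) is the set of $\beta \in U_\lambda(n)$ whose critical list is a flag critical list. $UBP_\lambda(n)$ (tuples bounded by their platform) is the set of $\beta \in U_\lambda(n)$ with $\beta_i \leq \Xi_\lambda(\beta)_i$ for all $i$. Lattice paths: lattice points are pairs $(a,b)$ of integers with $a \geq 0$, $b \geq 1$ (think of $a$ as the eastward coordinate and $b$ as the southward depth). A lattice path is a sequence of lattice points in which each consecutive step is either an easterly step $(a,b) \to (a+1,b)$ or a southerly step $(a,b) \to (a,b+1)$. An $n$-path is an $n$-tuple $(\Lambda_1,\dots,\Lambda_n)$ of lattice paths such that $\Lambda_m$ starts at $(n-m, m)$ for $m \in [n]$. Given $\beta \in U_\lambda(n)$, the terminals are the points $P_m := (\lambda_m + n - m, \beta_m)$, $m \in [n]$. For a permutation $\pi$ of $[n]$, let $\mathcal{LD}_\lambda(\beta;\pi)$ be the set of $n$-paths in which $\Lambda_m$ ends at $P_{\pi_m}$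 for each $m$ and no two distinct components share a lattice point. The terminal pair $(\lambda,\beta)$ is nonpermutable if $\mathcal{LD}_\lambda(\beta;\pi) = \emptyset$ for every permutation $\pi \neq (1,2,\dots,n)$. *)

theory Defs
  imports "HOL-Combinatorics.Permutations"
begin

text \<open>Conventions: n-tuples are functions nat => nat indexed by 1..n; values outside
  1..n are irrelevant. Carrels are identified by their right endpoint q in R_lambda union {n}.\<close>

definition is_partition :: "nat \<Rightarrow> (nat \<Rightarrow> nat) \<Rightarrow> bool" where
  "is_partition n lam \<longleftrightarrow> (\<forall>i\<in>{1..<n}. lam (Suc i) \<le> lam i)"

definition Rset :: "nat \<Rightarrow> (nat \<Rightarrow> nat) \<Rightarrow> nat set" where
  "Rset n lam = {q \<in> {1..n-1}. lam (Suc q) < lam q}"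

definition carrel_rgt :: "nat \<Rightarrow> (nat \<Rightarrow> nat) \<Rightarrow> nat \<Rightarrow> nat" where
  "carrel_rgt n lam i = Min {q \<in> Rset n lam \<union> {n}. i \<le> q}"

definition carrel_lft :: "nat \<Rightarrow> (nat \<Rightarrow> nat) \<Rightarrow> nat \<Rightarrow> nat" where
  "carrel_lft n lam q = Max ({0} \<union> {q' \<in> Rset n lam. q' < q})"

definition upper_tuple :: "nat \<Rightarrow> (nat \<Rightarrow> nat) \<Rightarrow> bool" where
  "upper_tuple n beta \<longleftrightarrow> (\<forall>i\<in>{1..n}. beta i \<in> {1..n} \<and> i \<le> beta i)"

definition U :: "(nat \<Rightarrow> nat) \<Rightarrow> nat \<Rightarrow> (nat \<Rightarrow> nat) set" where
  "U lam n = {beta. upper_tuple n beta}"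

inductive_set critset :: "nat \<Rightarrow> nat \<Rightarrow> (nat \<Rightarrow> nat) \<Rightarrow> nat set"
  for a b :: nat and beta :: "nat \<Rightarrow> nat" where
  crit_first: "a < b \<Longrightarrow> b \<in> critset a b beta"
| crit_next: "y \<in> critset a b beta \<Longrightarrow>
     {x. a < x \<and> x < y \<and> int (beta y) - int (beta x) > int y - int x} \<noteq> {} \<Longrightarrow>
     Max {x. a < x \<and> x < y \<and> int (beta y) - int (beta x) > int y - int x} \<in> critset a b beta"

definition crit_carrel :: "nat \<Rightarrow> (nat \<Rightarrow> nat) \<Rightarrow> (nat \<Rightarrow> nat) \<Rightarrow> nat \<Rightarrow> nat set" where
  "crit_carrel n lam beta q = critset (carrel_lft n lam q) q beta"

definition xidx :: "nat \<Rightarrow> (nat \<Rightarrow> nat) \<Rightarrow> (nat \<Rightarrow> nat) \<Rightarrow> nat \<Rightarrow> nat" where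
  "xidx n lam beta i = Min {x \<in> crit_carrel n lam beta (carrel_rgt n lam i). i \<le> x}"

definition platform :: "nat \<Rightarrow> (nat \<Rightarrow> nat) \<Rightarrow> (nat \<Rightarrow> nat) \<Rightarrow> nat \<Rightarrow> nat" where
  "platform n lam beta i = beta (xidx n lam beta i)"

definition flag_critical_list :: "nat \<Rightarrow> (nat \<Rightarrow> nat) \<Rightarrow> (nat \<Rightarrow> nat) \<Rightarrow> bool" where
  "flag_critical_list n lam beta \<longleftrightarrow>
     (\<forall>q\<in>Rset n lam. beta q \<le> beta (Min (crit_carrel n lam beta (carrel_rgt n lam (Suc q)))))"

definition UGC :: "(nat \<Rightarrow> nat) \<Rightarrow> nat \<Rightarrow> (nat \<Rightarrow> nat) set" where
  "UGC lam n = {beta \<in> U lam n. flag_critical_list n lam beta}"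

definition UBP :: "(nat \<Rightarrow> nat) \<Rightarrow> nat \<Rightarrow> (nat \<Rightarrow> nat) set" where
  "UBP lam n = {beta \<in> U lam n. \<forall>i\<in>{1..n}. beta i \<le> platform n lam beta i}"

text \<open>Lattice points (a,b) with a >= 0, b >= 1; paths with east/south unit steps.\<close>
definition lattice_path :: "(nat \<times> nat) list \<Rightarrow> bool" where
  "lattice_path p \<longleftrightarrow> p \<noteq> [] \<and> (\<forall>x\<in>set p. 1 \<le> snd x) \<and>
     (\<forall>i. Suc i < length p \<longrightarrow>
        p ! Suc i = (fst (p ! i) + 1, snd (p ! i)) \<or> p ! Suc i = (fst (p ! i), snd (p ! i) + 1))"

definition terminal :: "nat \<Rightarrow> (nat \<Rightarrow> nat) \<Rightarrow> (nat \<Rightarrow> nat) \<Rightarrow> nat \<Rightarrow> nat \<times> nat" where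
  "terminal n lam beta m = (lam m + n - m, beta m)"

definition LD :: "nat \<Rightarrow> (nat \<Rightarrow> nat) \<Rightarrow> (nat \<Rightarrow> nat) \<Rightarrow> (nat \<Rightarrow> nat) \<Rightarrow> (nat \<Rightarrow> (nat \<times> nat) list) set" where
  "LD n lam beta pi = {Lam.
     (\<forall>m. m \<notin> {1..n} \<longrightarrow> Lam m = []) \<and>
     (\<forall>m\<in>{1..n}. lattice_path (Lam m) \<and> hd (Lam m) = (n - m, m) \<and>
                  last (Lam m) = terminal n lam beta (pi m)) \<and>
     (\<forall>m\<in>{1..n}. \<forall>m'\<in>{1..n}. m \<noteq> m' \<longrightarrow> set (Lam m) \<inter> set (Lam m') = {})}"

definition nonpermutable :: "nat \<Rightarrow> (nat \<Rightarrow> nat) \<Rightarrow> (nat \<Rightarrow> nat) \<Rightarrow> bool" where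
  "nonpermutable n lam beta \<longleftrightarrow> (\<forall>pi. pi permutes {1..n} \<and> pi \<noteq> id \<longrightarrow> LD n lam beta pi = {})"

end

theory Submission
  imports Defs
begin

text \<open>Let \<open>P\<^sub>m\<close> be the terminals and let \<open>c\<^sub>m\<close> be the column of \<open>P\<^sub>m\<close>. Within a carrel the columns
  are consecutive, and \<open>\<beta>\<^sub>m - m\<close> measures the antidiagonal of \<open>P\<^sub>m\<close>; the critical indices are the strict
  right-to-left minima of \<open>\<beta>\<^sub>m - m\<close>. The tuple lies in \<open>UGC \<inter> UBP\<close> iff \<open>\<beta>\<^sub>l \<le> \<beta>\<^sub>x\<close> whenever \<open>l \<le> x\<close> and
  \<open>x\<close> is critical.

  All sources lie on one antidiagonal, so disjoint paths can be compared step by step and keep their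
  order. If the terminals are permuted, an inversion yields \<open>l < k\<close> such that the path to \<open>P\<^sub>l\<close> passes
  below \<open>P\<^sub>k\<close>. If \<open>x\<close> is the next critical index from \<open>k\<close> on, the condition above confines this path, on
  the antidiagonal of \<open>P\<^sub>x\<close>, to a stretch that is already filled by the paths to the terminals near
  \<open>P\<^sub>x\<close>. Conversely, if \<open>\<beta>\<^sub>l > \<beta>\<^sub>x\<close> for some critical \<open>x > l\<close>, then a family of paths with at most
  three bends realises a cycle on \<open>l, \<dots>, x\<close>.\<close>

section \<open>Carrels and critical indices\<close>

lemma finite_Rset: "finite (Rset n lam)"
  by (simp add: Rset_def)

lemma Rset_bounds: "q \<in> Rset n lam \<Longrightarrow> 1 \<le> q \<and> q < n"
  by (auto simp: Rset_def)

lemma carrel_rgt_props: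
  assumes "1 \<le> i" "i \<le> n"
  shows "carrel_rgt n lam i \<in> Rset n lam \<union> {n}" "i \<le> carrel_rgt n lam i"
    "carrel_rgt n lam i \<le> n"
    "\<And>z. z \<in> Rset n lam \<Longrightarrow> i \<le> z \<Longrightarrow> carrel_rgt n lam i \<le> z"
proof -
  let ?S = "{q \<in> Rset n lam \<union> {n}. i \<le> q}"
  have fin: "finite ?S" using finite_Rset by simp
  have "?S \<noteq> {}" using assms by auto
  from Min_in[OF fin this] show "carrel_rgt n lam i \<in> Rset n lam \<union> {n}" "i \<le> carrel_rgt n lam i"
    unfolding carrel_rgt_def by auto
  show "carrel_rgt n lam i \<le> n"
    unfolding carrel_rgt_def by (rule Min_le[OF fin]) (use assms in auto)
  show "carrel_rgt n lam i \<le> z" if "z \<in> Rset n lam" "i \<le> z" for z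
    unfolding carrel_rgt_def by (rule Min_le[OF fin]) (use that in auto)
qed

lemma carrel_lft_props:
  assumes "1 \<le> q"
  shows "carrel_lft n lam q < q" "carrel_lft n lam q \<in> insert 0 (Rset n lam)"
    "\<And>z. z \<in> Rset n lam \<Longrightarrow> z < q \<Longrightarrow> z \<le> carrel_lft n lam q"
proof -
  let ?S = "{0} \<union> {q' \<in> Rset n lam. q' < q}"
  have fin: "finite ?S" using finite_Rset by simp
  from Max_in[OF fin] have "carrel_lft n lam q \<in> ?S" unfolding carrel_lft_def by blast
  then show "carrel_lft n lam q < q" "carrel_lft n lam q \<in> insert 0 (Rset n lam)"
    using assms by auto
  show "z \<le> carrel_lft n lam q" if "z \<in> Rset n lam" "z < q" for z
    unfolding carrel_lft_def by (rule Max_ge[OF fin]) (use that in auto)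
qed

lemma carrel_lft_rgt_less:
  assumes "1 \<le> i" "i \<le> n"
  shows "carrel_lft n lam (carrel_rgt n lam i) < i"
proof (rule ccontr)
  let ?r = "carrel_rgt n lam i"
  assume "\<not> ?thesis"
  then have ge: "i \<le> carrel_lft n lam ?r" by simp
  have r: "1 \<le> ?r" using carrel_rgt_props(2)[OF assms, of lam] assms by simp
  have "carrel_lft n lam ?r \<in> Rset n lam"
    using carrel_lft_props(2)[OF r, of n lam] ge assms by auto
  then have "?r \<le> carrel_lft n lam ?r" using carrel_rgt_props(4)[OF assms] ge by blast
  then show False using carrel_lft_props(1)[OF r, of n lam] by simp
qed

lemma carrel_rgt_eq:
  assumes "r \<in> Rset n lam \<union> {n}" "carrel_lft n lam r < x" "x \<le> r"
  shows "carrel_rgt n lam x = r"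
  unfolding carrel_rgt_def
proof (rule Min_eqI)
  have r: "1 \<le> r" using assms by simp
  show "finite {q \<in> Rset n lam \<union> {n}. x \<le> q}" using finite_Rset by simp
  show "r \<in> {q \<in> Rset n lam \<union> {n}. x \<le> q}" using assms by simp
  show "r \<le> y" if y: "y \<in> {q \<in> Rset n lam \<union> {n}. x \<le> q}" for y
  proof (cases "y = n")
    case True then show ?thesis using assms Rset_bounds[of r n lam] by auto
  next
    case False
    then have "y \<in> Rset n lam" "x \<le> y" using y by auto
    then show ?thesis using carrel_lft_props(3)[OF r, of y n lam] assms by (cases "y < r") auto
  qed
qed

lemma lam_antimono:
  assumes "is_partition n lam" "1 \<le> i" "i \<le> j" "j \<le> n"
  shows "lam j \<le> lam i"
  using assms(3,4)
proof (induction j rule: dec_induct)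
  case (step m)
  then have "lam (Suc m) \<le> lam m" using assms by (auto simp: is_partition_def)
  then show ?case using step by simp
qed simp

lemma lam_const_in_carrel:
  assumes "is_partition n lam" "1 \<le> r" "r \<le> n" "carrel_lft n lam r < i" "i \<le> j" "j \<le> r"
  shows "lam j = lam i"
  using assms(5,6)
proof (induction j rule: dec_induct)
  case (step m)
  have "m \<notin> Rset n lam" using carrel_lft_props(3)[OF assms(2), of m n lam] step assms by auto
  moreover have "m \<in> {1..n-1}" using step assms by auto
  ultimately have "lam m \<le> lam (Suc m)" by (auto simp: Rset_def)
  moreover have "lam (Suc m) \<le> lam m" using lam_antimono[OF assms(1), of m "Suc m"] step assms by simp
  ultimately show ?case using step by simp
qed simp

section \<open>Critical indices as minima of \<open>beta m - m\<close>\<close>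

text \<open>The inequality compares \<open>beta x - x\<close> with \<open>beta y - y\<close>,
  written additively because subtraction on \<open>nat\<close> truncates. Indices skipped by the
  recursion failed the test, so their difference is at least that of the previous critical index,
  which in turn exceeds that of the new one.\<close>

lemma critset_right_minimum:
  assumes "x \<in> critset a b beta"
  shows "a < x \<and> x \<le> b \<and> (\<forall>y. x < y \<and> y \<le> b \<longrightarrow> beta x + y < beta y + x)"
  using assms
proof induction
  case (crit_next y)
  let ?S = "{x. a < x \<and> x < y \<and> int (beta y) - int (beta x) > int y - int x}"
  have fin: "finite ?S" by (rule finite_subset[of _ "{..y}"]) auto
  have "?S \<noteq> {}" using crit_next.hyps(2) by (auto simp: fun_eq_iff)
  then have m: "Max ?S \<in> ?S" using Max_in[OF fin] by blast
  have "beta (Max ?S) + z < beta z + Max ?S" if z: "Max ?S < z" "z \<le> b" for z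
  proof (cases z y rule: linorder_cases)
    case less
    have "z \<notin> ?S" using Max_ge[OF fin, of z] z(1) by (meson leD)
    then show ?thesis using less m z by auto
  next
    case equal then show ?thesis using m by auto
  next
    case greater
    then have "beta y + z < beta z + y" using crit_next.IH z by auto
    then show ?thesis using m by auto
  qed
  then show ?case using m crit_next.IH by auto
qed auto

lemma finite_critset: "finite (critset a b beta)"
  by (rule finite_subset[of _ "{..b}"]) (auto dest: critset_right_minimum)

text \<open>Here \<open>x\<close> is the next critical index from \<open>k\<close> on. If some
  \<open>z\<close> in between had a smaller difference \<open>beta z - z\<close>, the recursion
  would continue from \<open>x\<close> to a critical index that is at least \<open>z\<close> but
  below \<open>x\<close>, against minimality.\<close>

lemma Min_critset_ge:
  fixes a b k :: nat and beta :: "nat \<Rightarrow> nat"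
  assumes "a < k" "k \<le> b"
  defines "x \<equiv> Min {x \<in> critset a b beta. k \<le> x}"
  shows "x \<in> critset a b beta" "k \<le> x" "x \<le> b"
    "\<And>z. k \<le> z \<Longrightarrow> z \<le> x \<Longrightarrow> beta x + z \<le> beta z + x"
    "\<And>y. y \<in> critset a b beta \<Longrightarrow> k \<le> y \<Longrightarrow> x \<le> y"
proof -
  let ?C = "{x \<in> critset a b beta. k \<le> x}"
  have fin: "finite ?C" using finite_critset by simp
  have "b \<in> ?C" using assms by (auto intro: crit_first)
  then have "x \<in> ?C" unfolding x_def using Min_in[OF fin] by blast
  then show xc: "x \<in> critset a b beta" and kx: "k \<le> x" by auto
  then show "x \<le> b" using critset_right_minimum by blast
  show le: "x \<le> y" if "y \<in> critset a b beta" "k \<le> y" for y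
    unfolding x_def by (rule Min_le[OF fin]) (use that in auto)
  show "beta x + z \<le> beta z + x" if z: "k \<le> z" "z \<le> x" for z
  proof (rule ccontr)
    assume neg: "\<not> ?thesis"
    let ?S = "{z. a < z \<and> z < x \<and> int (beta x) - int (beta z) > int x - int z}"
    have fS: "finite ?S" by (rule finite_subset[of _ "{..x}"]) auto
    have "z \<noteq> x" using neg by auto
    then have zS: "z \<in> ?S" using neg z assms(1) by auto
    have "Max ?S \<in> critset a b beta"
      by (rule crit_next[OF xc]) (use zS in \<open>auto simp: fun_eq_iff\<close>)
    moreover have "z \<le> Max ?S" using Max_ge[OF fS zS] .
    ultimately have "x \<le> Max ?S" using le z by simp
    moreover have "Max ?S \<in> ?S" using Max_in[OF fS] zS by blast
    ultimately show False by simp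
  qed
qed

lemma xidx_props:
  assumes "1 \<le> k" "k \<le> n"
  shows "xidx n lam beta k \<in> crit_carrel n lam beta (carrel_rgt n lam k)"
    "k \<le> xidx n lam beta k" "xidx n lam beta k \<le> carrel_rgt n lam k"
    "\<And>z. k \<le> z \<Longrightarrow> z \<le> xidx n lam beta k \<Longrightarrow>
      beta (xidx n lam beta k) + z \<le> beta z + xidx n lam beta k"
    "\<And>y. y \<in> crit_carrel n lam beta (carrel_rgt n lam k) \<Longrightarrow> k \<le> y \<Longrightarrow> xidx n lam beta k \<le> y"
  using Min_critset_ge[OF carrel_lft_rgt_less[OF assms, of lam] carrel_rgt_props(2)[OF assms, of lam], where beta=beta]
  unfolding xidx_def crit_carrel_def by auto

lemma xidx_crit_eq:
  assumes "r \<in> Rset n lam \<union> {n}" "x \<in> crit_carrel n lam beta r"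
  shows "xidx n lam beta x = x"
proof -
  have x: "carrel_lft n lam r < x" "x \<le> r"
    using critset_right_minimum assms(2) unfolding crit_carrel_def by blast+
  have r: "carrel_rgt n lam x = r" using carrel_rgt_eq[OF assms(1) x] .
  have "1 \<le> x" "x \<le> n" using x assms(1) Rset_bounds[of r n lam] by auto
  from xidx_props(2)[OF this, of lam beta] xidx_props(5)[OF this, of x lam beta] show ?thesis
    using assms(2) r by auto
qed

lemma carrel_rgt_Suc:
  assumes "1 \<le> k" "k < n" "k \<notin> Rset n lam"
  shows "carrel_rgt n lam (Suc k) = carrel_rgt n lam k"
proof (rule carrel_rgt_eq)
  have k: "1 \<le> k" "k \<le> n" using assms by auto
  show r: "carrel_rgt n lam k \<in> Rset n lam \<union> {n}" using carrel_rgt_props(1)[OF k] .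
  show "carrel_lft n lam (carrel_rgt n lam k) < Suc k" using carrel_lft_rgt_less[OF k, of lam] by simp
  have "carrel_rgt n lam k \<noteq> k" using r assms by auto
  then show "Suc k \<le> carrel_rgt n lam k" using carrel_rgt_props(2)[OF k, of lam] by simp
qed

text \<open>This turns the flag condition into an inequality between the platform values at
  \<open>q\<close> and \<open>Suc q\<close>.\<close>

lemma Min_crit_next_carrel:
  assumes "q \<in> Rset n lam"
  shows "xidx n lam beta (Suc q) = Min (crit_carrel n lam beta (carrel_rgt n lam (Suc q)))"
proof -
  have q: "1 \<le> Suc q" "Suc q \<le> n" using Rset_bounds[OF assms] by auto
  let ?r = "carrel_rgt n lam (Suc q)"
  have r: "q < ?r" using carrel_rgt_props(2)[OF q, of lam] by simp
  have "q \<le> carrel_lft n lam ?r" using carrel_lft_props(3)[of ?r q n lam] r assms by auto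
  then have "{x \<in> crit_carrel n lam beta ?r. Suc q \<le> x} = crit_carrel n lam beta ?r"
    unfolding crit_carrel_def using critset_right_minimum by fastforce
  then show ?thesis unfolding xidx_def by simp
qed

section \<open>Membership in \<open>UGC\<close> and \<open>UBP\<close> as domination by critical
  values\<close>

text \<open>From \<open>k\<close> to \<open>Suc k\<close> the platform index changes only if
  \<open>k\<close> is itself critical. At a carrel end the flag condition applies; inside a carrel
  the strict minimum property gives \<open>beta k < beta x'\<close>, where \<open>x'\<close> is the
  next critical index.\<close>

lemma platform_mono:
  assumes flag: "flag_critical_list n lam beta" and "1 \<le> l" "l \<le> k" "k \<le> n"
  shows "platform n lam beta l \<le> platform n lam beta k"
  using assms(3,4)
proof (induction k rule: dec_induct)
  case (step k)
  have k: "1 \<le> k" "k \<le> n" and k': "1 \<le> Suc k" "Suc k \<le> n" using step assms(2) by auto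
  let ?x = "xidx n lam beta k" and ?x' = "xidx n lam beta (Suc k)"
  have "beta ?x \<le> beta ?x'"
  proof (cases "k \<in> Rset n lam")
    case True
    have "carrel_rgt n lam k = k"
      using carrel_rgt_props(2)[OF k, of lam] carrel_rgt_props(4)[OF k True] by simp
    then have "?x = k" using xidx_props(2,3)[OF k, of lam beta] by simp
    then show ?thesis using flag True Min_crit_next_carrel[OF True]
      unfolding flag_critical_list_def by simp
  next
    case False
    let ?r = "carrel_rgt n lam k"
    have r: "carrel_rgt n lam (Suc k) = ?r" using carrel_rgt_Suc[of k n lam] k k' False by simp
    show ?thesis
    proof (cases "?x = k")
      case True
      have "k \<in> critset (carrel_lft n lam ?r) ?r beta"
        using xidx_props(1)[OF k, of lam beta] True unfolding crit_carrel_def by simp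
      from critset_right_minimum[OF this] have "beta k + ?x' < beta ?x' + k"
        using xidx_props(2,3)[OF k', of lam beta] r by auto
      then show ?thesis using True xidx_props(2)[OF k', of lam beta] by simp
    next
      case False
      then have "Suc k \<le> ?x" using xidx_props(2)[OF k, of lam beta] by simp
      then have "?x' \<le> ?x" using xidx_props(5)[OF k', of ?x lam beta] xidx_props(1)[OF k, of lam beta] r by simp
      moreover have "?x \<le> ?x'"
        using xidx_props(5)[OF k, of ?x' lam beta] xidx_props(1,2)[OF k', of lam beta] r by simp
      ultimately show ?thesis by simp
    qed
  qed
  then show ?case using step unfolding platform_def by simp
qed simp

text \<open>Left to right, \<open>beta l\<close> is at most the platform at \<open>l\<close>, which
  is at most the platform at \<open>x\<close>, which is \<open>beta x\<close>. Conversely, apply the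
  right-hand side to the next critical index from \<open>k\<close> on: \<open>l = k\<close> gives
  the platform bound, and \<open>l = q\<close>, \<open>k = Suc q\<close> gives the flag
  condition.\<close>

lemma UGC_UBP_iff:
  assumes "beta \<in> U lam n"
  shows "beta \<in> UGC lam n \<inter> UBP lam n \<longleftrightarrow>
    (\<forall>r \<in> Rset n lam \<union> {n}. \<forall>x \<in> crit_carrel n lam beta r. \<forall>l\<in>{1..x}. beta l \<le> beta x)"
    (is "_ \<longleftrightarrow> ?rhs")
proof
  assume L: "beta \<in> UGC lam n \<inter> UBP lam n"
  show ?rhs
  proof (intro ballI)
    fix r x l assume r: "r \<in> Rset n lam \<union> {n}" and x: "x \<in> crit_carrel n lam beta r"
      and l: "l \<in> {1..x}"
    have "x \<le> r" using critset_right_minimum x unfolding crit_carrel_def by blast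
    then have xn: "x \<le> n" using r Rset_bounds[of r n lam] by auto
    have "beta l \<le> platform n lam beta l" using L l xn by (auto simp: UBP_def)
    also have "\<dots> \<le> platform n lam beta x"
      using platform_mono[of n lam beta l x] L l xn by (auto simp: UGC_def)
    finally show "beta l \<le> beta x" unfolding platform_def xidx_crit_eq[OF r x] .
  qed
next
  assume R: ?rhs
  have *: "beta l \<le> beta (xidx n lam beta k)" if "1 \<le> l" "l \<le> k" "k \<le> n" for l k
  proof -
    have k: "1 \<le> k" "k \<le> n" using that by auto
    then show ?thesis
      using R carrel_rgt_props(1)[OF k, of lam] xidx_props(1,2)[OF k, of lam beta] that
      by (meson atLeastAtMost_iff le_trans)
  qed
  have "flag_critical_list n lam beta" unfolding flag_critical_list_def
  proof
    fix q assume q: "q \<in> Rset n lam"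
    then show "beta q \<le> beta (Min (crit_carrel n lam beta (carrel_rgt n lam (Suc q))))"
      using *[of q "Suc q"] Rset_bounds[OF q] Min_crit_next_carrel[OF q] by simp
  qed
  then show "beta \<in> UGC lam n \<inter> UBP lam n"
    using assms * by (auto simp: UGC_def UBP_def platform_def)
qed

section \<open>Lattice paths\<close>

lemma lattice_path_sum:
  assumes "lattice_path p" "fst (hd p) + snd (hd p) = s" "i < length p"
  shows "fst (p ! i) + snd (p ! i) = s + i"
  using assms(3)
proof (induction i)
  case 0
  then show ?case using assms by (cases p) auto
next
  case (Suc i)
  then have "p ! Suc i = (fst (p ! i) + 1, snd (p ! i)) \<or> p ! Suc i = (fst (p ! i), snd (p ! i) + 1)"
    using assms(1) unfolding lattice_path_def by blast
  then show ?case using Suc by auto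
qed

lemma lattice_path_mono:
  assumes "lattice_path p" "i \<le> j" "j < length p"
  shows "fst (p ! i) \<le> fst (p ! j) \<and> snd (p ! i) \<le> snd (p ! j)"
  using assms(2,3)
proof (induction j rule: dec_induct)
  case (step j)
  then have "p ! Suc j = (fst (p ! j) + 1, snd (p ! j)) \<or> p ! Suc j = (fst (p ! j), snd (p ! j) + 1)"
    using assms(1) unfolding lattice_path_def by blast
  then show ?case using step by auto
qed simp

lemma lattice_path_le_last:
  assumes "lattice_path p" "i < length p"
  shows "fst (p ! i) \<le> fst (last p)" "snd (p ! i) \<le> snd (last p)"
proof -
  have "last p = p ! (length p - 1)" "i \<le> length p - 1" "length p - 1 < length p"
    using assms by (auto simp: last_conv_nth lattice_path_def)
  then show "fst (p ! i) \<le> fst (last p)" "snd (p ! i) \<le> snd (last p)"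
    using lattice_path_mono[OF assms(1)] by auto
qed

text \<open>At equal list index both paths are on the same antidiagonal. One step changes a depth by
  at most one, so to change order they would first have to agree in depth, hence share a
  point.\<close>

lemma disjoint_paths_stay_ordered:
  assumes "lattice_path p" "lattice_path q" "set p \<inter> set q = {}"
    and "fst (hd p) + snd (hd p) = s" "fst (hd q) + snd (hd q) = s" "snd (hd p) < snd (hd q)"
    and "i < length p" "i < length q"
  shows "snd (p ! i) < snd (q ! i)"
  using assms(7,8)
proof (induction i)
  case 0
  then show ?case using assms(6) by (cases p; cases q) auto
next
  case (Suc i)
  have "p ! Suc i = (fst (p ! i) + 1, snd (p ! i)) \<or> p ! Suc i = (fst (p ! i), snd (p ! i) + 1)"
    "q ! Suc i = (fst (q ! i) + 1, snd (q ! i)) \<or> q ! Suc i = (fst (q ! i), snd (q ! i) + 1)"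
    using assms(1,2) Suc.prems unfolding lattice_path_def by blast+
  then have le: "snd (p ! Suc i) \<le> snd (q ! Suc i)" using Suc by auto
  have "p ! Suc i \<noteq> q ! Suc i" using assms(3) Suc.prems by (metis disjoint_iff nth_mem)
  moreover have "fst (p ! Suc i) + snd (p ! Suc i) = fst (q ! Suc i) + snd (q ! Suc i)"
    using lattice_path_sum[OF assms(1,4)] lattice_path_sum[OF assms(2,5)] Suc.prems by simp
  ultimately have "snd (p ! Suc i) \<noteq> snd (q ! Suc i)" by (auto simp: prod_eq_iff)
  then show ?case using le by simp
qed

section \<open>Construction of paths with prescribed bends\<close>

lemma lattice_path_join:
  assumes p: "lattice_path p" and q: "lattice_path q" and pq: "last p = hd q"
  shows "lattice_path (p @ tl q) \<and> hd (p @ tl q) = hd p \<and> last (p @ tl q) = last q \<and>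
    set (p @ tl q) = set p \<union> set q"
proof -
  have ne: "p \<noteq> []" "q \<noteq> []" using p q by (auto simp: lattice_path_def)
  \<comment> \<open>The last entry of \<open>p\<close> counts as entry 0 of \<open>q\<close>, so
    every step from the seam on is a step of \<open>q\<close>.\<close>
  have nth: "(p @ tl q) ! i = q ! (Suc i - length p)" if "length p \<le> Suc i" "Suc i < length p + length q" for i
  proof (cases "length p = Suc i")
    case True
    then have "(p @ tl q) ! i = last p" using ne by (simp add: nth_append last_conv_nth)
    then show ?thesis using True pq ne by (simp add: hd_conv_nth)
  next
    case False
    then have "\<not> i < length p" using that by simp
    moreover have "i - length p < length q - 1" using that False by simp
    ultimately show ?thesis using that False by (simp add: nth_append nth_tl Suc_diff_le)
  qed
  have lq: "last (p @ tl q) = last q" using ne pq by (cases q) (auto simp: last_append)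
  have "hd q \<in> set p" using pq ne by (metis last_in_set)
  then have st: "set (p @ tl q) = set p \<union> set q" using ne by (cases q) auto
  have "(p @ tl q) ! Suc i = (fst ((p @ tl q) ! i) + 1, snd ((p @ tl q) ! i)) \<or>
      (p @ tl q) ! Suc i = (fst ((p @ tl q) ! i), snd ((p @ tl q) ! i) + 1)"
    if i: "Suc i < length (p @ tl q)" for i
  proof (cases "Suc i < length p")
    case True
    then show ?thesis using p by (auto simp: lattice_path_def nth_append)
  next
    case False
    let ?j = "Suc i - length p"
    have j: "Suc ?j < length q" using i False by auto
    then have "(p @ tl q) ! i = q ! ?j" "(p @ tl q) ! Suc i = q ! Suc ?j"
      using nth[of i] nth[of "Suc i"] False i by (auto simp: Suc_diff_le)
    then show ?thesis using q j unfolding lattice_path_def by simp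
  qed
  then show ?thesis using lq st ne p q by (auto simp: lattice_path_def)
qed

lemma east_path_exists:
  assumes "u \<le> u'" "1 \<le> v"
  shows "\<exists>p. lattice_path p \<and> hd p = (u, v) \<and> last p = (u', v) \<and> set p = {u..u'} \<times> {v}"
proof -
  let ?p = "map (\<lambda>i. (i, v)) [u..<Suc u']"
  have "lattice_path ?p" using assms by (auto simp: lattice_path_def nth_append simp del: upt_Suc)
  moreover have "hd ?p = (u, v)" "last ?p = (u', v)" "set ?p = {u..u'} \<times> {v}"
    using assms by (auto simp: hd_map last_map simp del: upt_Suc)
  ultimately show ?thesis by blast
qed

lemma south_path_exists:
  assumes "v \<le> v'" "1 \<le> v"
  shows "\<exists>p. lattice_path p \<and> hd p = (u, v) \<and> last p = (u, v') \<and> set p = {u} \<times> {v..v'}"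
proof -
  let ?p = "map (\<lambda>i. (u, i)) [v..<Suc v']"
  have "lattice_path ?p" using assms by (auto simp: lattice_path_def nth_append simp del: upt_Suc)
  moreover have "hd ?p = (u, v)" "last ?p = (u, v')" "set ?p = {u} \<times> {v..v'}"
    using assms by (auto simp: hd_map last_map simp del: upt_Suc)
  ultimately show ?thesis by blast
qed

text \<open>The path runs east, south, east, south; each segment may degenerate to a point. It turns
  first at column \<open>a\<close>, and its second eastward run is in row \<open>b\<close>.\<close>

lemma bent_path_exists:
  assumes "s \<le> a" "a \<le> c" "m \<le> b" "b \<le> e" "1 \<le> m"
  shows "\<exists>p. lattice_path p \<and> hd p = (s, m) \<and> last p = (c, e) \<and>
    set p = {s..a} \<times> {m} \<union> {a} \<times> {m..b} \<union> {a..c} \<times> {b} \<union> {c} \<times> {b..e}"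
proof -
  obtain p1 where 1: "lattice_path p1" "hd p1 = (s, m)" "last p1 = (a, m)" "set p1 = {s..a} \<times> {m}"
    using east_path_exists[of s a m] assms by auto
  obtain p2 where 2: "lattice_path p2" "hd p2 = (a, m)" "last p2 = (a, b)" "set p2 = {a} \<times> {m..b}"
    using south_path_exists[of m b a] assms by auto
  obtain p3 where 3: "lattice_path p3" "hd p3 = (a, b)" "last p3 = (c, b)" "set p3 = {a..c} \<times> {b}"
    using east_path_exists[of a c b] assms by auto
  obtain p4 where 4: "lattice_path p4" "hd p4 = (c, b)" "last p4 = (c, e)" "set p4 = {c} \<times> {b..e}"
    using south_path_exists[of b e c] assms by auto
  obtain p where "lattice_path p" "hd p = (s, m)" "last p = (a, b)"
    "set p = {s..a} \<times> {m} \<union> {a} \<times> {m..b}"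
    using lattice_path_join[OF 1(1) 2(1)] 1 2 by auto
  then obtain q where "lattice_path q" "hd q = (s, m)" "last q = (c, b)"
    "set q = {s..a} \<times> {m} \<union> {a} \<times> {m..b} \<union> {a..c} \<times> {b}"
    using lattice_path_join[OF _ 3(1), of p] 3 by auto
  then show ?thesis using lattice_path_join[OF _ 4(1), of q] 4 by metis
qed

text \<open>Take for \<open>m\<close> the least moved point and for \<open>m'\<close> its preimage:
  everything below \<open>m\<close> is fixed, so both \<open>m'\<close> and \<open>\<pi> m\<close>
  exceed \<open>m\<close>.\<close>

lemma permutes_inversion:
  fixes \<pi> :: "nat \<Rightarrow> nat"
  assumes "\<pi> permutes {1..n}" "\<pi> \<noteq> id"
  obtains m m' where "1 \<le> m" "m < m'" "m' \<le> n" "\<pi> m' < \<pi> m"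
proof -
  have ex: "\<exists>m. \<pi> m \<noteq> m" using assms(2) by auto
  define m where "m = (LEAST m. \<pi> m \<noteq> m)"
  have m: "\<pi> m \<noteq> m" unfolding m_def using ex by (rule LeastI_ex)
  have fix_less: "\<pi> j = j" if "j < m" for j using not_less_Least that unfolding m_def by blast
  have inj: "inj \<pi>" using assms(1) by (rule permutes_inj)
  obtain m' where m': "\<pi> m' = m" using permutes_surj[OF assms(1)] by (metis surj_def)
  have min: "m \<in> {1..n}" using m assms(1) by (metis permutes_def)
  have "m' \<noteq> m" using m m' by auto
  then have "m < m'" using fix_less[of m'] m' by (cases "m' < m") auto
  moreover have "m' \<in> {1..n}" using min m' assms(1) by (metis permutes_in_image)
  moreover have "\<not> \<pi> m < m" using fix_less[of "\<pi> m"] inj m by (metis injD)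
  ultimately show ?thesis using that[of m m'] min m m' by auto
qed

section \<open>The two implications\<close>

lemma LD_empty_of_critical_bound:
  assumes part: "is_partition n lam" and up: "upper_tuple n beta"
    and crit: "\<And>r x l. r \<in> Rset n lam \<union> {n} \<Longrightarrow> x \<in> crit_carrel n lam beta r \<Longrightarrow>
      1 \<le> l \<Longrightarrow> l \<le> x \<Longrightarrow> beta l \<le> beta x"
    and perm: "\<pi> permutes {1..n}" "\<pi> \<noteq> id"
  shows "LD n lam beta \<pi> = {}"
proof (rule ccontr)
  assume "LD n lam beta \<pi> \<noteq> {}"
  then obtain Lam where L: "Lam \<in> LD n lam beta \<pi>" by blast
  have lp: "lattice_path (Lam m)" and hd: "hd (Lam m) = (n - m, m)"
    and lst: "last (Lam m) = (lam (\<pi> m) + n - \<pi> m, beta (\<pi> m))"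
    and len: "0 < length (Lam m)" if "1 \<le> m" "m \<le> n" for m
    using L that by (auto simp: LD_def terminal_def lattice_path_def)
  have dis: "set (Lam m) \<inter> set (Lam m') = {}" if "1 \<le> m" "m \<le> n" "1 \<le> m'" "m' \<le> n" "m \<noteq> m'" for m m'
    using L that unfolding LD_def by auto
  have sm: "fst (Lam m ! i) + snd (Lam m ! i) = n + i" if "1 \<le> m" "m \<le> n" "i < length (Lam m)" for m i
    using lattice_path_sum[OF lp, of m n i] hd that by simp
  have end_sum: "lam (\<pi> m) + n - \<pi> m + beta (\<pi> m) + 1 = n + length (Lam m)" if "1 \<le> m" "m \<le> n" for m
    using sm[OF that, of "length (Lam m) - 1"] lst[OF that] len[OF that] by (simp add: last_conv_nth)
  obtain m m' where mm: "1 \<le> m" "m < m'" "m' \<le> n" and inv: "\<pi> m' < \<pi> m"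
    using permutes_inversion[OF perm] .
  define k l where "k = \<pi> m" and "l = \<pi> m'"
  have m: "1 \<le> m" "m \<le> n" and m': "1 \<le> m'" "m' \<le> n" using mm by auto
  have k: "1 \<le> k" "k \<le> n" and l: "1 \<le> l" "l < k"
    using permutes_in_image[OF perm(1), of m] permutes_in_image[OF perm(1), of m'] m m' inv
    by (auto simp: k_def l_def)
  define r x where "r = carrel_rgt n lam k" and "x = xidx n lam beta k"
  have r: "r \<in> Rset n lam \<union> {n}" "k \<le> r" "r \<le> n"
    using carrel_rgt_props[OF k] by (auto simp: r_def)
  have x: "x \<in> crit_carrel n lam beta r" "k \<le> x" "x \<le> r"
    and diag: "\<And>z. k \<le> z \<Longrightarrow> z \<le> x \<Longrightarrow> beta x + z \<le> beta z + x"
    using xidx_props[OF k, where lam=lam and beta=beta] by (auto simp: r_def x_def)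
  have bnd: "beta z \<le> beta x" if "1 \<le> z" "z \<le> x" for z using crit[OF r(1) x(1) that] .
  have lamz: "lam z = lam x" if "k \<le> z" "z \<le> x" for z
    using lam_const_in_carrel[OF part, of r z x] carrel_lft_rgt_less[OF k, of lam] r k x that
    by (simp add: r_def)
  have ux: "x \<le> beta x" using up k x r by (auto simp: upper_tuple_def)
  \<comment> \<open>\<open>cx\<close> is the column of the terminal at \<open>x\<close>. Sources
    have coordinate sum \<open>n\<close>, so \<open>t\<close> is the list index at which any path
    still running meets the antidiagonal of that terminal; \<open>x \<le> beta x\<close> keeps the
    subtraction exact.\<close>
  define t cx where "t = lam x + beta x - x" and "cx = lam x + n - x"
  have cz: "lam z + n - z = cx + (x - z)" if "k \<le> z" "z \<le> x" for z
    using lamz[OF that] that x r by (simp add: cx_def)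
  have t: "n + t = cx + beta x" using ux x r by (simp add: t_def cx_def)
  \<comment> \<open>Paths are relabelled by their terminal instead of their source.\<close>
  define Q where "Q z = Lam (inv \<pi> z)" for z
  have src: "1 \<le> inv \<pi> z" "inv \<pi> z \<le> n" "\<pi> (inv \<pi> z) = z" if "1 \<le> z" "z \<le> n" for z
    using permutes_in_image[OF permutes_inv[OF perm(1)], of z] that permutes_inverses[OF perm(1)] by auto
  have Qm: "Q k = Lam m" "Q l = Lam m'" unfolding Q_def k_def l_def
    using permutes_inverses[OF perm(1)] by auto
  have Qlast: "fst (last (Q z)) = lam z + n - z" "snd (last (Q z)) = beta z" if "1 \<le> z" "z \<le> n" for z
    using lst[OF src(1,2)[OF that]] src(3)[OF that] by (auto simp: Q_def)
  have Qle: "fst (Q z ! i) \<le> lam z + n - z" "snd (Q z ! i) \<le> beta z"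
    if "1 \<le> z" "z \<le> n" "i < length (Q z)" for z i
    using lattice_path_le_last[OF lp[OF src(1,2)[OF that(1,2)]], of i] that(3) Qlast[OF that(1,2)]
    by (auto simp: Q_def)
  have Qend: "lam z + n - z + beta z + 1 = n + length (Q z)" if "1 \<le> z" "z \<le> n" for z
    using end_sum[OF src(1,2)[OF that]] src(3)[OF that] by (simp add: Q_def)
  have Qsum: "fst (Q z ! i) + snd (Q z ! i) = n + i" if "1 \<le> z" "z \<le> n" "i < length (Q z)" for z i
    using sm[OF src(1,2)[OF that(1,2)]] that(3) by (simp add: Q_def)
  have Qdis: "Q z ! i \<noteq> Q z' ! i"
    if "1 \<le> z" "z \<le> n" "1 \<le> z'" "z' \<le> n" "z \<noteq> z'" "i < length (Q z)" "i < length (Q z')" for z z' i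
  proof -
    have "inv \<pi> z \<noteq> inv \<pi> z'" using src(3)[OF that(1,2)] src(3)[OF that(3,4)] that(5) by metis
    then have "set (Q z) \<inter> set (Q z') = {}"
      using dis[OF src(1,2)[OF that(1,2)] src(1,2)[OF that(3,4)]] by (simp add: Q_def)
    then show ?thesis using that(6,7) by (metis disjoint_iff nth_mem)
  qed
  have ln: "1 \<le> l" "l \<le> n" using l k by auto
  have ord: "snd (Q k ! i) < snd (Q l ! i)" if "i < length (Q k)" "i < length (Q l)" for i
    using disjoint_paths_stay_ordered[OF lp[OF m] lp[OF m'] dis[OF m m'], of n i] hd[OF m] hd[OF m'] mm that
    by (auto simp: Qm)
  \<comment> \<open>If \<open>Q l\<close> ended first, \<open>Q k\<close> would at that moment be
    strictly east of terminal \<open>l\<close>, yet terminal \<open>k\<close> lies west of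
    it.\<close>
  have lk: "length (Q k) \<le> length (Q l)"
  proof (rule ccontr)
    assume neg: "\<not> ?thesis"
    let ?i = "length (Q l) - 1"
    have i: "?i < length (Q l)" "?i < length (Q k)" using len[OF m'] neg by (auto simp: Qm)
    have "Q l ! ?i = last (Q l)" using i by (metis last_conv_nth length_0_conv not_less_zero)
    then have "fst (Q l ! ?i) = lam l + n - l" using Qlast[OF ln] by simp
    moreover have "fst (Q l ! ?i) < fst (Q k ! ?i)" using ord[OF i(2,1)] Qsum[OF k i(2)] Qsum[OF ln i(1)] by simp
    moreover have "fst (Q k ! ?i) \<le> lam k + n - k" using Qle[OF k i(2)] by simp
    moreover have "lam k \<le> lam l" using lam_antimono[OF part, of l k] l k by simp
    ultimately show False using l k by simp
  qed
  \<comment> \<open>In this range \<open>lam\<close> is constant and \<open>beta z - z\<close> is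
    smallest at \<open>x\<close>, so no such path ends before the antidiagonal of terminal
    \<open>x\<close>.\<close>
  have tlen: "t < length (Q z)" if "k \<le> z" "z \<le> x" for z
    using Qend[of z] cz[OF that] diag[OF that] t that k x r by simp
  have tk: "t < length (Q k)" using tlen x by simp
  have tl: "t < length (Q l)" using tk lk by simp
  define u where "u = fst (Q l ! t)"
  \<comment> \<open>On a fixed antidiagonal a bound on the depth is a lower bound on the column; the
    hypothesis supplies \<open>beta l \<le> beta x\<close>.\<close>
  have u_ge: "cx \<le> u" using Qsum[OF ln tl] Qle(2)[OF ln tl] bnd[of l] l x t by (simp add: u_def)
  \<comment> \<open>When \<open>Q k\<close> reaches its terminal, \<open>Q l\<close> is strictly
    west of it, and \<open>Q l\<close> was no further east at index \<open>t\<close>.\<close>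
  have u_less: "u < cx + (x - k)"
  proof -
    let ?i = "length (Q k) - 1"
    have i: "?i < length (Q k)" "?i < length (Q l)" "t \<le> ?i" using tk lk by auto
    have "Q k ! ?i = last (Q k)" using i by (metis last_conv_nth length_0_conv not_less_zero)
    then have "fst (Q k ! ?i) = cx + (x - k)" using Qlast[OF k] cz[of k] x by simp
    moreover have "fst (Q l ! ?i) < fst (Q k ! ?i)" using ord[OF i(1,2)] Qsum[OF k i(1)] Qsum[OF ln i(2)] by simp
    moreover have "u \<le> fst (Q l ! ?i)"
      unfolding u_def using lattice_path_mono[OF lp[OF m'] i(3)] i(2) by (simp add: Qm)
    ultimately show ?thesis by simp
  qed
  \<comment> \<open>Columns of terminals in a carrel are consecutive, so column \<open>u\<close> is
    that of a unique terminal \<open>y\<close>.\<close>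
  define y where "y = x - (u - cx)"
  have y: "k < y" "y \<le> x" "u = cx + (x - y)" using u_ge u_less x by (auto simp: y_def)
  \<comment> \<open>Pigeonhole on the antidiagonal through the critical terminal \<open>P\<^sub>x\<close>: the paths to
    \<open>P\<^sub>y, \<dots>, P\<^sub>x\<close> and the path to \<open>P\<^sub>l\<close> all cross it in the columns of \<open>P\<^sub>y, \<dots>, P\<^sub>x\<close>.\<close>
  let ?Z = "insert l {y..x}" and ?g = "\<lambda>z. fst (Q z ! t)"
  have Zn: "1 \<le> z" "z \<le> n" "t < length (Q z)" if "z \<in> ?Z" for z
    using that ln tl tlen[of z] y k x r by auto
  have "inj_on ?g ?Z"
  proof (rule inj_onI, rule ccontr)
    fix z z' assume z: "z \<in> ?Z" "z' \<in> ?Z" "?g z = ?g z'" "z \<noteq> z'"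
    then have "Q z ! t = Q z' ! t"
      using Qsum[OF Zn[OF z(1)]] Qsum[OF Zn[OF z(2)]] by (simp add: prod_eq_iff)
    then show False using Qdis[of z z' t] Zn z by blast
  qed
  moreover have "?g ` ?Z \<subseteq> {cx..cx + (x - y)}"
  proof
    fix w assume "w \<in> ?g ` ?Z"
    then obtain z where z: "z \<in> ?Z" "w = ?g z" by blast
    show "w \<in> {cx..cx + (x - y)}"
    proof (cases "z = l")
      case True then show ?thesis using z u_ge y by (simp add: u_def)
    next
      case False
      then have zz: "y \<le> z" "z \<le> x" using z by auto
      have "w \<le> cx + (x - z)" using Qle(1)[OF Zn[OF z(1)]] cz[of z] zz y z by simp
      moreover have "cx \<le> w"
        using Qsum[OF Zn[OF z(1)]] Qle(2)[OF Zn[OF z(1)]] bnd[of z] Zn(1)[OF z(1)] zz t z by simp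
      ultimately show ?thesis using zz by simp
    qed
  qed
  ultimately have "card ?Z \<le> card {cx..cx + (x - y)}"
    by (intro card_inj_on_le) auto
  moreover have "card ?Z = x - y + 2" using y l by simp
  ultimately show False by simp
qed

section \<open>Realising a cycle when a critical value is exceeded\<close>

lemma cycle_permutes:
  assumes "1 \<le> l" "l < x" "x \<le> (n::nat)"
  shows "(\<lambda>m. if m = x then l else if l \<le> m \<and> m < x then Suc m else m) permutes {1..n}"
    (is "?\<pi> permutes _")
proof (rule bij_imp_permutes)
  have "inj_on ?\<pi> {1..n}" using assms by (auto simp: inj_on_def split: if_splits)
  moreover have "?\<pi> ` {1..n} \<subseteq> {1..n}" using assms by auto
  ultimately show "bij_betw ?\<pi> {1..n} {1..n}"
    unfolding bij_betw_def using endo_inj_surj[of "{1..n}" ?\<pi>] by blast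
  show "\<And>m. m \<notin> {1..n} \<Longrightarrow> ?\<pi> m = m" using assms by auto
qed

text \<open>With \<open>l < x\<close> maximal subject to \<open>\<beta>\<^sub>l > \<beta>\<^sub>x\<close>, the paths from \<open>l, \<dots>, x - 1\<close> are shifted to the
  terminals \<open>l + 1, \<dots>, x\<close>, and the path from \<open>x\<close> passes just below \<open>P\<^sub>x\<close> and runs east to \<open>P\<^sub>l\<close>.
  The paths from \<open>x + 1, \<dots>, r\<close> give way to it; criticality of \<open>x\<close> leaves them just enough room.\<close>

lemma LD_nonempty_of_critical_violation:
  assumes part: "is_partition n lam" and up: "upper_tuple n beta"
    and r: "r \<in> Rset n lam \<union> {n}" and x: "x \<in> crit_carrel n lam beta r"
    and l0: "1 \<le> l0" "l0 \<le> x" "beta x < beta l0"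
  shows "\<exists>\<pi>. \<pi> permutes {1..n} \<and> \<pi> \<noteq> id \<and> LD n lam beta \<pi> \<noteq> {}"
proof -
  have xr: "carrel_lft n lam r < x" "x \<le> r"
    and crit: "\<And>y. x < y \<Longrightarrow> y \<le> r \<Longrightarrow> beta x + y < beta y + x"
    using critset_right_minimum x unfolding crit_carrel_def by blast+
  have rn: "r \<le> n" "1 \<le> r" using r xr Rset_bounds[of r n lam] by auto
  have upm: "m \<le> beta m" "beta m \<le> n" if "1 \<le> m" "m \<le> n" for m
    using up that by (auto simp: upper_tuple_def)
  define l where "l = Max {l \<in> {1..<x}. beta x < beta l}"
  have fin: "finite {l \<in> {1..<x}. beta x < beta l}" by simp
  have "l0 \<noteq> x" using l0 by auto
  then have "l0 \<in> {l \<in> {1..<x}. beta x < beta l}" using l0 by auto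
  then have "l \<in> {l \<in> {1..<x}. beta x < beta l}" unfolding l_def using Max_in[OF fin] by blast
  then have l: "1 \<le> l" "l < x" "beta x < beta l" by auto
  \<comment> \<open>This keeps the terminals \<open>l + 1, ..., x\<close> above row
    \<open>beta x + 1\<close>, along which the path from \<open>x\<close> will run east.\<close>
  have lmax: "beta z \<le> beta x" if "l < z" "z \<le> x" for z
  proof (rule ccontr)
    assume "\<not> ?thesis"
    then have "z \<in> {l \<in> {1..<x}. beta x < beta l}" using that l by (cases "z = x") auto
    then have "z \<le> l" unfolding l_def using Max_ge[OF fin] by blast
    then show False using that by simp
  qed
  have lamr: "lam z = lam x" if "x \<le> z" "z \<le> r" for z
    using lam_const_in_carrel[OF part, of r x z] rn xr that by simp
  \<comment> \<open>Zero parts would put \<open>x\<close> in the last carrel, where criticality and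
    \<open>beta n \<le> n\<close> leave no room for \<open>beta l > beta x\<close>. Positivity is
    what allows a path to turn one column before its terminal.\<close>
  have pos: "0 < lam x"
  proof (rule ccontr)
    assume "\<not> ?thesis"
    then have "lam r = 0" using lamr[of r] xr by simp
    then have rn: "r = n" using r by (auto simp: Rset_def)
    show False
    proof (cases "x = n")
      case True
      then show ?thesis using upm[of x] upm[of l] l xr rn by simp
    next
      case False
      then show ?thesis using crit[of n] upm[of x] upm[of n] l xr rn by simp
    qed
  qed
  define c where "c m = lam m + n - m" for m
  have cdec: "c z + (z - y) \<le> c y" if "1 \<le> y" "y \<le> z" "z \<le> n" for y z
    using lam_antimono[OF part that] that by (simp add: c_def)
  have cless: "c z < c y" if "1 \<le> y" "y < z" "z \<le> n" for y z
    using cdec[of y z] that by simp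
  \<comment> \<open>After the carrel end \<open>r\<close> columns drop by at least two, so the
    column just west of each terminal up to \<open>r\<close> stays clear of the later paths.\<close>
  have cr: "c z + 1 < c y" if "1 \<le> y" "y \<le> r" "r < z" "z \<le> n" for y z
  proof -
    have "r \<in> Rset n lam" using r that by auto
    then have "lam (Suc r) < lam r" by (auto simp: Rset_def)
    then have "c (Suc r) + 1 < c r" using that by (simp add: c_def)
    then show ?thesis using cdec[of "Suc r" z] cdec[of y r] that by simp
  qed
  have cpos: "n - m < c m" if "1 \<le> m" "m \<le> r" for m
    using lam_antimono[OF part that rn(1)] lamr[of r] xr pos that rn by (simp add: c_def)
  have cstep: "c m = c x - (m - x)" "m - x < c x" if "x \<le> m" "m \<le> r" for m
    using lamr[OF that] that rn pos by (auto simp: c_def)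
  define \<pi> where "\<pi> = (\<lambda>m. if m = x then l else if l \<le> m \<and> m < x then Suc m else m)"
  have xn: "x \<le> n" using xr rn by simp
  have perm: "\<pi> permutes {1..n}" unfolding \<pi>_def using cycle_permutes[OF l(1,2) xn] .
  have "\<pi> x \<noteq> x" using l by (simp add: \<pi>_def)
  then have nid: "\<pi> \<noteq> id" by auto
  define J where "J = {x..r}"
  \<comment> \<open>Paths outside \<open>J\<close> go east to their terminal column, then south. A
    path in \<open>J\<close> turns south at column \<open>c m - 1\<close>, then east in row
    \<open>b m\<close>; these rows descend by one per index, starting just below terminal
    \<open>x\<close>. For \<open>m > x\<close>, criticality of \<open>x\<close> gives
    \<open>b m \<le> beta m\<close>.\<close>
  define a where "a m = (if m \<in> J then c m - 1 else c (\<pi> m))" for m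
  define b where "b m = (if m \<in> J then beta x + (m - x) + 1 else m)" for m
  define P where "P m = {n - m..a m} \<times> {m} \<union> {a m} \<times> {m..b m} \<union> {a m..c (\<pi> m)} \<times> {b m} \<union>
    {c (\<pi> m)} \<times> {b m..beta (\<pi> m)}" for m
  have ex: "\<exists>p. lattice_path p \<and> hd p = (n - m, m) \<and> last p = (c (\<pi> m), beta (\<pi> m)) \<and> set p = P m"
    if m: "1 \<le> m" "m \<le> n" for m
    unfolding P_def
  proof (rule bent_path_exists)
    show "1 \<le> m" by fact
    consider "m = x" | "x < m" "m \<le> r" | "l \<le> m" "m < x" | "m < l" | "r < m" by linarith
    then have "n - m \<le> a m \<and> a m \<le> c (\<pi> m) \<and> m \<le> b m \<and> b m \<le> beta (\<pi> m)"
    proof cases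
      case 1
      then show ?thesis using cpos[of x] cless[of l x] l upm[of x] xr xn m
        by (auto simp: a_def b_def \<pi>_def J_def)
    next
      case 2
      then show ?thesis using cpos[of m] crit[of m] upm[of x] l xn m
        by (auto simp: a_def b_def \<pi>_def J_def)
    next
      case 3
      then show ?thesis using cpos[of "Suc m"] upm[of "Suc m"] xr xn m
        by (auto simp: a_def b_def \<pi>_def J_def)
    next
      case 4
      then show ?thesis using cpos[of m] upm[of m] l xr m
        by (auto simp: a_def b_def \<pi>_def J_def)
    next
      case 5
      then show ?thesis using upm[of m] l xr m
        by (auto simp: a_def b_def \<pi>_def J_def c_def)
    qed
    then show "n - m \<le> a m" "a m \<le> c (\<pi> m)" "m \<le> b m" "b m \<le> beta (\<pi> m)" by auto
  qed
  \<comment> \<open>From column \<open>a m\<close> on, \<open>P m\<close> is east of all of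
    \<open>P m'\<close>; its initial run in row \<open>m\<close> is above all of
    \<open>P m'\<close>.\<close>
  have far: "P m \<inter> P m' = {}" if "m < m'" "c (\<pi> m') < a m" "m' \<le> b m'" "a m' \<le> c (\<pi> m')"
    "a m \<le> c (\<pi> m)" for m m'
    using that by (auto simp: P_def)
  have b_ge: "m \<le> b m" if "m \<le> n" for m
    using upm[of x] l xn by (auto simp: b_def J_def)
  have a_le: "a m \<le> c (\<pi> m)" if "m \<le> n" for m
    using cless[of l x] l xn by (auto simp: a_def J_def \<pi>_def)
  have disj: "P m \<inter> P m' = {}" if m: "1 \<le> m" "m < m'" "m' \<le> n" for m m'
  proof -
    \<comment> \<open>Column separation by \<open>far\<close> settles all cases but two. For
      consecutive paths in \<open>J\<close>, the later one ends in the column where the earlier one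
      descends, but meets it only below row \<open>b m\<close>. Against the path from
      \<open>x\<close>, the shifted paths from \<open>l, ..., x - 1\<close> end above row
      \<open>beta x + 1\<close>.\<close>
    consider "r < m'" | "x < m'" "m' \<le> r" "m < x" | "x < m'" "m' \<le> r" "x \<le> m" "Suc m < m'"
      | "x < m'" "m' \<le> r" "x \<le> m" "m' = Suc m" | "m' = x" "m < l" | "m' = x" "l \<le> m"
      | "m' < x" using m by linarith
    then show ?thesis
    proof cases
      case 1
      then have "c (\<pi> m') < a m"
        using cr[of m m'] cless[of m m'] cless[of "Suc m" m'] m l xr
        by (auto simp: a_def \<pi>_def J_def)
      then show ?thesis using far b_ge a_le m by simp
    next
      case 2
      then have "c (\<pi> m') < a m"
        using cless[of m m'] cless[of "Suc m" m'] m l xr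
        by (auto simp: a_def \<pi>_def J_def)
      then show ?thesis using far b_ge a_le m by simp
    next
      case 3
      then have "c (\<pi> m') < a m"
        using cdec[of m m'] m l xr
        by (auto simp: a_def \<pi>_def J_def)
      then show ?thesis using far b_ge a_le m by simp
    next
      case 4
      have "c m' = c m - 1" "0 < c m'" using cstep[of m] cstep[of m'] 4 by auto
      then have "c (\<pi> m') = a m" "a m' < a m" "b m < b m'" "a m < c (\<pi> m)" "m' \<le> b m'"
        using 4 cless[of l x] l xn m b_ge[of m'] by (auto simp: a_def b_def \<pi>_def J_def)
      then show ?thesis using m by (auto simp: P_def)
    next
      case 5
      then have "c (\<pi> m') < a m"
        using cless[of m l] m l xn
        by (auto simp: a_def \<pi>_def J_def)
      then show ?thesis using far b_ge a_le m by simp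
    next
      case 6
      have "c x \<le> c (Suc m)" using cdec[of "Suc m" x] 6 m by simp
      then have "a m' < a m" "a m = c (\<pi> m)" "b m = m" "beta (\<pi> m) < b m'" "m' \<le> b m'"
        using 6 m cpos[of x] lmax[of "Suc m"] b_ge[of m'] xr by (auto simp: a_def b_def \<pi>_def J_def)
      then show ?thesis using m by (auto simp: P_def)
    next
      case 7
      then have "c (\<pi> m') < a m"
        using cless[of m m'] cless[of "Suc m" m'] cless[of "Suc m" "Suc m'"] cless[of m "Suc m'"] m xn
        by (auto simp: a_def \<pi>_def J_def)
      then show ?thesis using far b_ge a_le m by simp
    qed
  qed
  obtain p where p: "\<And>m. 1 \<le> m \<Longrightarrow> m \<le> n \<Longrightarrow> lattice_path (p m) \<and> hd (p m) = (n - m, m) \<and>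
      last (p m) = (c (\<pi> m), beta (\<pi> m)) \<and> set (p m) = P m"
    using ex by metis
  have disj': "P m \<inter> P m' = {}" if "1 \<le> m" "m \<le> n" "1 \<le> m'" "m' \<le> n" "m \<noteq> m'" for m m'
    using disj[of m m'] disj[of m' m] that by (cases m m' rule: linorder_cases) auto
  \<comment> \<open>\<open>LD\<close> fixes the family to be the empty list off
    \<open>{1..n}\<close>, hence the default value.\<close>
  have "(\<lambda>m. if m \<in> {1..n} then p m else []) \<in> LD n lam beta \<pi>"
    unfolding LD_def using p disj' by (auto simp: terminal_def c_def)
  then show ?thesis using perm nid by blast
qed

theorem theorem5p1:
  fixes n :: nat and lam beta :: "nat \<Rightarrow> nat"
  assumes "1 \<le> n"
    and "is_partition n lam"
    and "beta \<in> U lam n"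
  shows "nonpermutable n lam beta \<longleftrightarrow> beta \<in> UGC lam n \<inter> UBP lam n"
proof -
  have up: "upper_tuple n beta" using assms(3) by (simp add: U_def)
  show ?thesis unfolding UGC_UBP_iff[OF assms(3)]
  proof
    assume "nonpermutable n lam beta"
    then show "\<forall>r\<in>Rset n lam \<union> {n}. \<forall>x\<in>crit_carrel n lam beta r. \<forall>l\<in>{1..x}. beta l \<le> beta x"
      using LD_nonempty_of_critical_violation[OF assms(2) up]
      unfolding nonpermutable_def by (meson atLeastAtMost_iff not_le)
  next
    assume "\<forall>r\<in>Rset n lam \<union> {n}. \<forall>x\<in>crit_carrel n lam beta r. \<forall>l\<in>{1..x}. beta l \<le> beta x"
    then have "LD n lam beta \<pi> = {}" if "\<pi> permutes {1..n}" "\<pi> \<noteq> id" for \<pi>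
      using LD_empty_of_critical_bound[OF assms(2) up _ that] by (meson atLeastAtMost_iff)
    then show "nonpermutable n lam beta" unfolding nonpermutable_def by blast
  qed
qed

end
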